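(* Let $\mathcal{V}$ be a Euclidean Jordan algebra of rank $n$ carrying the trace inner product, and let $T:\mathcal{V}\to\mathcal{V}$ be a linear map. Then the following are equivalent: (i) There exists a vector $q\in\mathbb{R}^n$ with decreasing components (i.e. $q_1\ge q_2\ge\cdots\ge q_n$) such that $\lambda(T(x))\prec q*\lambda(x)$ for all $x\in\mathcal{V}$. (ii) $T$ is a (real) scalar multiple of a doubly stochastic map on $\mathcal{V}$.
   Context: A Euclidean Jordan algebra $(\mathcal{V},\circ,\langle\cdot,\cdot\rangle)$ is a finite-dimensional real inner product space with a bilinear commutative product $\circ$ satisfying the Jordan identity $x\circ(x^2\circ y)=x^2\circ(x\circ y)$ (with $x^2=x\circ x$) and $\langle x\circ y,z\rangle=\langle x,y\circ z\rangle$ for all $x,y,z$, with unit element $e$. If $\mathcal{V}$ has rank $n$, every $x\in\mathcal{V}$ has a spectral decomposition $x=\sum_{i=1}^n x_ie_i$ with $\{e_1,\dots,e_n\}$ a Jordan frame (mutually orthogonal primitive idempotents summing to $e$) and $x_i\in\mathbb{R}$ the eigenvalues of $x$ (uniquely determined up to order). Here $\operatorname{tr}(x)=\sum_i x_i$, and the inner product is the trace inner product $\langle x,y\rangle=\operatorname{tr}(x\circ y)$. The eigenvalue vector $\lambda(x)\in\mathbb{R}^n$ is the vector of eigenvalues of $x$ in decreasing order. The symmetric cone is $\mathcal{V}_+=\{x\in\mathcal{V}:\text{all eigenvalues of }x\text{ are}\ge 0\}$. A linear map $D:\mathcal{V}\to\mathcal{V}$ is doubly stochastic if $D(\mathcal{V}_+)\subseteq\mathcal{V}_+$,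 $D(e)=e$ and $D^*(e)=e$, where $D^*$ is the adjoint of $D$. For $p,q\in\mathbb{R}^n$: $p*q$ is the componentwise product, $p^\downarrow$ is the decreasing rearrangement of $p$, and $p\prec q$ (majorization) means $\sum_{i=1}^k p_i^\downarrow\le\sum_{i=1}^k q_i^\downarrow$ for all $1\le k\le n$, with equality for $k=n$. *)

theory Defs
  imports "HOL-Analysis.Analysis"
begin

text \<open>The given inner product on the algebra is the one carried by the
  type class \<^class>\<open>euclidean_space\<close>.\<close>

locale euclidean_jordan_algebra =
  fixes jprod :: "'a::euclidean_space \<Rightarrow> 'a \<Rightarrow> 'a" (infixl "\<odot>" 70)
    and e :: 'a
  assumes bilinear: "bilinear (\<odot>)"
    and commute: "x \<odot> y = y \<odot> x"
    and jordan_identity: "x \<odot> ((x \<odot> x) \<odot> y) = (x \<odot> x) \<odot> (x \<odot> y)"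
    and inner_assoc: "inner (x \<odot> y) z = inner x (y \<odot> z)"
    and left_unit: "e \<odot> x = x"

fun jpower :: "('a \<Rightarrow> 'a \<Rightarrow> 'a) \<Rightarrow> 'a \<Rightarrow> 'a \<Rightarrow> nat \<Rightarrow> 'a" where
  "jpower jprod e x 0 = e"
| "jpower jprod e x (Suc k) = jprod x (jpower jprod e x k)"

text \<open>The degree of the minimal polynomial of \<open>x\<close>: the least \<open>k > 0\<close> for which the
  family \<open>e, x, x^2, ..., x^k\<close> is linearly dependent. It is at most the dimension,
  so the maximum in the definition of the rank is taken over a finite set.\<close>

definition jdegree ::
    "('a::euclidean_space \<Rightarrow> 'a \<Rightarrow> 'a) \<Rightarrow> 'a \<Rightarrow> 'a \<Rightarrow> nat" where
  "jdegree jprod e x =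
     (LEAST k. 0 < k \<and>
        (\<exists>a :: nat \<Rightarrow> real. (\<exists>i\<le>k. a i \<noteq> 0) \<and> (\<Sum>i\<le>k. a i *\<^sub>R jpower jprod e x i) = 0))"

definition jrank :: "('a::euclidean_space \<Rightarrow> 'a \<Rightarrow> 'a) \<Rightarrow> 'a \<Rightarrow> nat" where
  "jrank jprod e = Max (range (jdegree jprod e))"

definition idempotent :: "('a \<Rightarrow> 'a \<Rightarrow> 'a) \<Rightarrow> 'a \<Rightarrow> bool" where
  "idempotent jprod c \<longleftrightarrow> jprod c c = c"

definition primitive_idempotent ::
    "('a::euclidean_space \<Rightarrow> 'a \<Rightarrow> 'a) \<Rightarrow> 'a \<Rightarrow> bool" where
  "primitive_idempotent jprod c \<longleftrightarrow>
     idempotent jprod c \<and> c \<noteq> 0 \<and>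
     \<not> (\<exists>a b. idempotent jprod a \<and> idempotent jprod b \<and> a \<noteq> 0 \<and> b \<noteq> 0 \<and>
              jprod a b = 0 \<and> c = a + b)"

definition jordan_frame ::
    "('a::euclidean_space \<Rightarrow> 'a \<Rightarrow> 'a) \<Rightarrow> 'a \<Rightarrow> 'a list \<Rightarrow> bool" where
  "jordan_frame jprod e es \<longleftrightarrow>
     (\<forall>c\<in>set es. primitive_idempotent jprod c) \<and>
     (\<forall>i<length es. \<forall>j<length es. i \<noteq> j \<longrightarrow> jprod (es ! i) (es ! j) = 0) \<and>
     sum_list es = e"

definition spectral_decomposition ::
    "('a::euclidean_space \<Rightarrow> 'a \<Rightarrow> 'a) \<Rightarrow> 'a \<Rightarrow> 'a \<Rightarrow> real list \<Rightarrow> 'a list \<Rightarrow> bool" where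
  "spectral_decomposition jprod e x xs es \<longleftrightarrow>
     jordan_frame jprod e es \<and> length xs = length es \<and>
     x = (\<Sum>i<length es. xs ! i *\<^sub>R es ! i)"

text \<open>Vectors in real \<open>n\<close>-space, with \<open>n\<close> the rank, are lists of length \<open>n\<close>. In a Euclidean
  Jordan algebra every element has a decreasing list of eigenvalues, it is unique, and
  its length is the rank, so the choice below does not depend on the choice operator.\<close>

definition eigvals ::
    "('a::euclidean_space \<Rightarrow> 'a \<Rightarrow> 'a) \<Rightarrow> 'a \<Rightarrow> 'a \<Rightarrow> real list" where
  "eigvals jprod e x =
     (SOME xs. sorted_wrt (\<ge>) xs \<and> (\<exists>es. spectral_decomposition jprod e x xs es))"

definition jtrace ::
    "('a::euclidean_space \<Rightarrow> 'a \<Rightarrow> 'a) \<Rightarrow> 'a \<Rightarrow> 'a \<Rightarrow> real" where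
  "jtrace jprod e x = sum_list (eigvals jprod e x)"

definition carries_trace_inner_product ::
    "('a::euclidean_space \<Rightarrow> 'a \<Rightarrow> 'a) \<Rightarrow> 'a \<Rightarrow> bool" where
  "carries_trace_inner_product jprod e \<longleftrightarrow>
     (\<forall>x y. inner x y = jtrace jprod e (jprod x y))"

definition symmetric_cone ::
    "('a::euclidean_space \<Rightarrow> 'a \<Rightarrow> 'a) \<Rightarrow> 'a \<Rightarrow> 'a set" where
  "symmetric_cone jprod e = {x. \<forall>l\<in>set (eigvals jprod e x). 0 \<le> l}"

definition doubly_stochastic ::
    "('a::euclidean_space \<Rightarrow> 'a \<Rightarrow> 'a) \<Rightarrow> 'a \<Rightarrow> ('a \<Rightarrow> 'a) \<Rightarrow> bool" where
  "doubly_stochastic jprod e D \<longleftrightarrow>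
     linear D \<and> D ` symmetric_cone jprod e \<subseteq> symmetric_cone jprod e \<and>
     D e = e \<and> adjoint D e = e"

definition decreasing_rearrangement :: "real list \<Rightarrow> real list" where
  "decreasing_rearrangement p = rev (sort p)"

definition majorized_by :: "real list \<Rightarrow> real list \<Rightarrow> bool" (infix "\<prec>" 50) where
  "p \<prec> q \<longleftrightarrow>
     length p = length q \<and>
     (\<forall>k\<in>{1..length p}.
        sum_list (take k (decreasing_rearrangement p))
          \<le> sum_list (take k (decreasing_rearrangement q))) \<and>
     sum_list (decreasing_rearrangement p) = sum_list (decreasing_rearrangement q)"

text \<open>Only applied to lists of equal length.\<close>

definition componentwise_product :: "real list \<Rightarrow> real list \<Rightarrow> real list" (infixl "\<star>" 70) where
  "p \<star> q = map2 (*) p q"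

end

theory Submission
  imports Defs
begin

text \<open>
  Suppose that the decreasing vector \<open>q\<close> satisfies \<open>\<lambda>(T x) \<prec> q * \<lambda>(x)\<close> for all \<open>x\<close>.
  Majorization preserves the sum of the entries, and the sum of the eigenvalues is the linear
  functional \<open>\<langle>_, e\<rangle>\<close>. A primitive idempotent \<open>c\<close> has eigenvalues \<open>(1, 0, \<dots>, 0)\<close> and \<open>- c\<close> has
  \<open>(0, \<dots>, 0, -1)\<close>, so testing with \<open>c\<close> and with \<open>- c\<close> gives \<open>\<langle>T c, e\<rangle> = q\<^sub>1\<close> and
  \<open>\<langle>T (- c), e\<rangle> = - q\<^sub>n\<close>. Hence \<open>q\<^sub>1 = q\<^sub>n\<close>, all entries of \<open>q\<close> equal one number \<open>t\<close>
  (\<open>constant_multiplier\<close>), and the hypothesis becomes \<open>\<lambda>(T x) \<prec> \<lambda>(t x)\<close>. If \<open>t = 0\<close> then \<open>T = 0\<close>.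
  Otherwise \<open>D = T / t\<close> satisfies \<open>\<lambda>(D x) \<prec> \<lambda>(x)\<close>, and the three conditions for a doubly
  stochastic map are read off: a majorized vector stays between the extreme entries of the
  majorizing one, which gives positivity and \<open>D e = e\<close>, and has the same sum, which gives
  \<open>D\<^sup>* e = e\<close> (\<open>doubly_stochastic_if_majorizing\<close>).

  Conversely let \<open>D\<close> be doubly stochastic. If \<open>x = \<Sum> x\<^sub>i e\<^sub>i\<close> and \<open>D x = \<Sum> y\<^sub>j f\<^sub>j\<close> are spectral
  decompositions, then \<open>y\<^sub>j = \<Sum>\<^sub>i \<langle>D e\<^sub>i, f\<^sub>j\<rangle> x\<^sub>i\<close>, and the matrix \<open>\<langle>D e\<^sub>i, f\<^sub>j\<rangle>\<close> is doubly
  stochastic, so that \<open>y \<prec> x\<close> (\<open>spectral_majorization\<close>). Applied to \<open>t x\<close>, this gives the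
  majorization for \<open>T = t D\<close> with the constant vector \<open>q = (t, \<dots>, t)\<close>.

  What these arguments rest on is the spectral theorem. Multiplication by \<open>x\<close> is
  selfadjoint, so \<open>e\<close> is a sum of its eigenvectors within the span of the powers of \<open>x\<close>. The Jordan
  identity makes multiplication by a power commute with multiplication by \<open>x\<close>, and this turns the
  eigenvectors into orthogonal idempotents (\<open>spectral_idempotents\<close>). A largest system of nonzero
  orthogonal idempotents that sum to \<open>e\<close> and of which \<open>x\<close> is a combination consists of primitive
  ones (\<open>primitive_spectral_idempotents\<close>). The trace inner
  product makes every primitive idempotent a unit vector, so every Jordan frame has \<open>\<langle>e, e\<rangle>\<close>
  elements; counting roots of polynomials shows that this number is the rank. Uniqueness of the
  eigenvalues is the case \<open>D = id\<close> of \<open>spectral_majorization\<close>, because two decreasing vectors that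
  majorize each other are equal.
\<close>

section \<open>Majorization of real lists\<close>

lemma decreasing_rearrangement_sorted:
  "sorted_wrt (\<ge>) xs \<Longrightarrow> decreasing_rearrangement xs = xs"
  unfolding decreasing_rearrangement_def
  using properties_for_sort[of "rev xs" xs] by (simp add: sorted_wrt_rev)

lemma decreasing_nth_le:
  fixes xs :: "real list"
  assumes "sorted_wrt (\<ge>) xs" "i \<le> j" "j < length xs"
  shows "xs ! j \<le> xs ! i"
  using assms by (cases "i = j") (auto simp: sorted_wrt_iff_nth_less)

lemma decreasing_rearrangement_simps [simp]:
  "length (decreasing_rearrangement xs) = length xs"
  "set (decreasing_rearrangement xs) = set xs"
  by (simp_all add: decreasing_rearrangement_def)

lemma sum_list_decreasing_rearrangement:
  fixes xs :: "real list" shows "sum_list (decreasing_rearrangement xs) = sum_list xs"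
  using sum_mset_sum_list[of "decreasing_rearrangement xs"] sum_mset_sum_list[of xs]
  by (simp add: decreasing_rearrangement_def)

lemma decreasing_rearrangement_cong_mset:
  "mset xs = mset ys \<Longrightarrow> decreasing_rearrangement xs = decreasing_rearrangement ys"
  unfolding decreasing_rearrangement_def by (metis properties_for_sort sorted_sort mset_sort)

lemma majorized_by_cong_mset:
  fixes p q r :: "real list"
  shows "mset q = mset r \<Longrightarrow> p \<prec> q \<longleftrightarrow> p \<prec> r"
  using decreasing_rearrangement_cong_mset[of q r] mset_eq_length[of q r]
  by (simp add: majorized_by_def)

lemma majorized_by_sum_list:
  fixes p q :: "real list"
  shows "p \<prec> q \<Longrightarrow> sum_list p = sum_list q"
  by (simp add: majorized_by_def sum_list_decreasing_rearrangement)

lemma sum_list_take_sum: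
  fixes xs :: "real list"
  assumes "k \<le> length xs" shows "sum_list (take k xs) = (\<Sum>i<k. xs ! i)"
  using assms by (simp add: sum_list_sum_nth atLeast0LessThan min_def)

lemma majorized_by_sorted_iff:
  fixes p q :: "real list"
  assumes "sorted_wrt (\<ge>) p" "sorted_wrt (\<ge>) q"
  shows "p \<prec> q \<longleftrightarrow> length p = length q \<and> (\<forall>k\<le>length p. (\<Sum>i<k. p ! i) \<le> (\<Sum>i<k. q ! i))
     \<and> (\<Sum>i<length p. p ! i) = (\<Sum>i<length q. q ! i)"
proof -
  have "(\<forall>k\<in>{1..length p}. sum_list (take k p) \<le> sum_list (take k q))
    \<longleftrightarrow> (\<forall>k\<le>length p. (\<Sum>i<k. p ! i) \<le> (\<Sum>i<k. q ! i))" if "length p = length q"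
  proof -
    have "(\<forall>k\<in>{1..length p}. sum_list (take k p) \<le> sum_list (take k q))
      \<longleftrightarrow> (\<forall>k\<in>{1..length p}. (\<Sum>i<k. p ! i) \<le> (\<Sum>i<k. q ! i))"
      using that by (intro ball_cong) (simp_all add: sum_list_take_sum)
    also have "\<dots> \<longleftrightarrow> (\<forall>k\<le>length p. (\<Sum>i<k. p ! i) \<le> (\<Sum>i<k. q ! i))"
    proof safe
      fix k assume "\<forall>k\<in>{1..length p}. (\<Sum>i<k. p ! i) \<le> (\<Sum>i<k. q ! i)" "k \<le> length p"
      thus "(\<Sum>i<k. p ! i) \<le> (\<Sum>i<k. q ! i)" by (cases "k = 0") auto
    qed auto
    finally show ?thesis .
  qed
  thus ?thesis
    by (auto simp: majorized_by_def assms decreasing_rearrangement_sorted sum_list_sum_nth atLeast0LessThan)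
qed

text \<open>The upper bound compares the largest entries. The lower bound compares the smallest ones: the sums
of all entries agree, while the sums of all entries but the smallest are ordered.\<close>

lemma majorized_by_bounds:
  fixes p q :: "real list"
  assumes "p \<prec> q" "\<And>l. l \<in> set q \<Longrightarrow> a \<le> l \<and> l \<le> b" "x \<in> set p"
  shows "a \<le> x \<and> x \<le> b"
proof -
  define p' q' where "p' = decreasing_rearrangement p" and "q' = decreasing_rearrangement q"
  have s: "sorted_wrt (\<ge>) p'" "sorted_wrt (\<ge>) q'"
    by (simp_all add: p'_def q'_def decreasing_rearrangement_def sorted_wrt_rev)
  have "p' \<prec> q'" using assms(1) s
    by (simp add: majorized_by_def p'_def q'_def decreasing_rearrangement_sorted)
  hence maj: "length p' = length q'" "\<And>k. k \<le> length p' \<Longrightarrow> (\<Sum>i<k. p' ! i) \<le> (\<Sum>i<k. q' ! i)"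
    "(\<Sum>i<length p'. p' ! i) = (\<Sum>i<length q'. q' ! i)"
    unfolding majorized_by_sorted_iff[OF s] by blast+
  obtain i where i: "i < length p'" "x = p' ! i"
    using assms(3) by (metis in_set_conv_nth p'_def decreasing_rearrangement_simps(2))
  then obtain m where m: "length p' = Suc m" by (cases "length p'") auto
  have q: "a \<le> q' ! j \<and> q' ! j \<le> b" if "j < Suc m" for j
    using assms(2) that maj(1) m by (metis nth_mem q'_def decreasing_rearrangement_simps(2))
  have "p' ! i \<le> p' ! 0" "p' ! m \<le> p' ! i"
    using decreasing_nth_le[OF s(1)] i m by simp_all
  moreover have "p' ! 0 \<le> q' ! 0" using maj(2)[of 1] m by simp
  moreover have "q' ! m \<le> p' ! m" using maj(2)[of m] maj(3) by (simp add: m flip: maj(1))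
  ultimately show ?thesis using q[of 0] q[of m] i(2) by simp
qed

lemma majorized_by_antisym:
  fixes p q :: "real list"
  assumes "sorted_wrt (\<ge>) p" "sorted_wrt (\<ge>) q" "p \<prec> q" "q \<prec> p"
  shows "p = q"
proof (rule nth_equalityI)
  show len: "length p = length q" using assms(3) by (simp add: majorized_by_def)
  fix i assume i: "i < length p"
  have "(\<Sum>i<k. p ! i) = (\<Sum>i<k. q ! i)" if "k \<le> length p" for k
    using that assms len by (intro antisym) (simp_all add: majorized_by_sorted_iff)
  from this[of i] this[of "Suc i"] i show "p ! i = q ! i" by simp
qed

text \<open>A total weight of \<open>k\<close>, with at most \<open>1\<close> on each entry, is best spent on the \<open>k\<close> largest entries.
Subtracting the \<open>k\<close>-th largest entry from all entries changes both sides by the same amount, and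
afterwards the inequality holds term by term.\<close>

lemma weighted_sum_le_prefix_sum:
  fixes x w :: "nat \<Rightarrow> real"
  assumes anti: "\<And>i j. i \<le> j \<Longrightarrow> j < n \<Longrightarrow> x j \<le> x i" and k: "k \<le> n"
    and w: "\<And>i. i < n \<Longrightarrow> 0 \<le> w i \<and> w i \<le> 1" and sum: "(\<Sum>i<n. w i) = k"
  shows "(\<Sum>i<n. w i * x i) \<le> (\<Sum>i<k. x i)"
proof (cases "k = 0")
  case True
  hence "\<forall>i<n. w i = 0" using sum w sum_nonneg_eq_0_iff[of "{..<n}" w] by simp
  thus ?thesis using True by simp
next
  case False
  define y where "y = x (k - 1)"
  have "(\<Sum>i<n. w i * (x i - y)) \<le> (\<Sum>i<n. if i < k then x i - y else 0)"
  proof (rule sum_mono)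
    fix i assume "i \<in> {..<n}"
    hence i: "i < n" by simp
    show "w i * (x i - y) \<le> (if i < k then x i - y else 0)"
    proof (cases "i < k")
      case True
      hence "x i - y \<ge> 0" using anti[of i "k - 1"] k by (simp add: y_def)
      thus ?thesis using True w[OF i] mult_right_mono[of "w i" 1 "x i - y"] by simp
    next
      case F: False
      hence "x i - y \<le> 0" using anti[of "k - 1" i] i by (simp add: y_def)
      thus ?thesis using F w[OF i] by (simp add: mult_nonneg_nonpos)
    qed
  qed
  also have "\<dots> = (\<Sum>i<k. x i - y)"
    using k by (intro sum.mono_neutral_cong_right) auto
  finally show ?thesis
    by (simp add: right_diff_distrib sum_subtractf sum flip: sum_distrib_right)
qed

text \<open>The easy half of the Hardy-Littlewood-Polya theorem: the sum of \<open>k\<close> entries of \<open>A x\<close> weights the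
entries of \<open>x\<close> by partial column sums, which are at most \<open>1\<close> and add up to \<open>k\<close>.\<close>

lemma doubly_stochastic_matrix_majorization:
  fixes xs ys :: "real list" and A :: "nat \<Rightarrow> nat \<Rightarrow> real"
  assumes sorted: "sorted_wrt (\<ge>) xs" "sorted_wrt (\<ge>) ys" and len: "length xs = n" "length ys = n"
    and nonneg: "\<And>i j. i < n \<Longrightarrow> j < n \<Longrightarrow> 0 \<le> A j i"
    and row: "\<And>j. j < n \<Longrightarrow> (\<Sum>i<n. A j i) = 1" and col: "\<And>i. i < n \<Longrightarrow> (\<Sum>j<n. A j i) = 1"
    and ys: "\<And>j. j < n \<Longrightarrow> ys ! j = (\<Sum>i<n. A j i * xs ! i)"
  shows "ys \<prec> xs"
proof -
  have swap: "(\<Sum>j<k. ys ! j) = (\<Sum>i<n. (\<Sum>j<k. A j i) * xs ! i)" if "k \<le> n" for k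
  proof -
    have "(\<Sum>j<k. ys ! j) = (\<Sum>j<k. \<Sum>i<n. A j i * xs ! i)"
      using that ys by (intro sum.cong) auto
    thus ?thesis by (simp add: sum.swap[of _ "{..<k}"] sum_distrib_right)
  qed
  have "(\<Sum>j<k. ys ! j) \<le> (\<Sum>i<k. xs ! i)" if k: "k \<le> n" for k
    unfolding swap[OF k]
  proof (rule weighted_sum_le_prefix_sum[OF _ k])
    show "xs ! j \<le> xs ! i" if "i \<le> j" "j < n" for i j
      using decreasing_nth_le[OF sorted(1)] that len(1) by simp
    show "0 \<le> (\<Sum>j<k. A j i) \<and> (\<Sum>j<k. A j i) \<le> 1" if i: "i < n" for i
    proof
      show "0 \<le> (\<Sum>j<k. A j i)" using i k nonneg by (intro sum_nonneg) auto
      have "(\<Sum>j<k. A j i) \<le> (\<Sum>j<n. A j i)" using i k nonneg by (intro sum_mono2) auto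
      thus "(\<Sum>j<k. A j i) \<le> 1" using col[OF i] by simp
    qed
    have "(\<Sum>i<n. \<Sum>j<k. A j i) = (\<Sum>j<k. \<Sum>i<n. A j i)" by (rule sum.swap)
    also have "\<dots> = (\<Sum>j<k. 1)" using k row by (intro sum.cong) auto
    finally show "(\<Sum>i<n. \<Sum>j<k. A j i) = k" by simp
  qed
  moreover have "(\<Sum>j<n. ys ! j) = (\<Sum>i<n. xs ! i)"
    unfolding swap[OF order_refl] by (intro sum.cong) (auto simp: col)
  ultimately show ?thesis
    by (simp add: majorized_by_sorted_iff[OF sorted(2,1)] len)
qed

section \<open>Selfadjoint linear maps\<close>

text \<open>A maximizer \<open>u\<close> of the Rayleigh quotient on \<open>S\<close> is an eigenvector: along the residual
\<open>r = \<mu> u - L u\<close>, which lies in \<open>S\<close>, the first variation of the quotient is proportional to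
\<open>\<langle>r, r\<rangle>\<close>, so it has to vanish.\<close>

lemma selfadjoint_has_eigenvector:
  fixes L :: "'a::euclidean_space \<Rightarrow> 'a"
  assumes lin: "linear L" and adj: "\<And>u v. inner (L u) v = inner u (L v)"
    and S: "subspace S" and inv: "\<And>v. v \<in> S \<Longrightarrow> L v \<in> S" and ne: "z \<in> S" "z \<noteq> 0"
  obtains u \<mu> where "u \<in> S" "u \<noteq> 0" "L u = \<mu> *\<^sub>R u"
proof -
  let ?K = "S \<inter> sphere 0 1"
  have "compact ?K"
    by (simp add: closed_subspace[OF S] compact_Int_closed inf_commute closed_Int_compact)
  moreover have "(1 / norm z) *\<^sub>R z \<in> ?K"
    using ne by (simp add: subspace_scale[OF S])
  hence "?K \<noteq> {}" by blast
  moreover have "continuous_on ?K (\<lambda>v. inner (L v) v)"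
    by (intro continuous_intros linear_continuous_on linear_conv_bounded_linear[THEN iffD1, OF lin])
  ultimately obtain u where u: "u \<in> ?K" and umax: "\<And>v. v \<in> ?K \<Longrightarrow> inner (L v) v \<le> inner (L u) u"
    using continuous_attains_sup[of ?K "\<lambda>v. inner (L v) v"] by blast
  define \<mu> where "\<mu> = inner (L u) u"
  have uS: "u \<in> S" and u1: "inner u u = 1"
    using u by (auto simp: dot_square_norm)
  have le: "inner (L v) v \<le> \<mu> * inner v v" if v: "v \<in> S" for v
  proof (cases "v = 0")
    case True then show ?thesis using linear_0[OF lin] by simp
  next
    case False
    have "(1 / norm v) *\<^sub>R v \<in> ?K"
      using False v by (simp add: subspace_scale[OF S])
    from umax[OF this] have "inner (L v) v / (norm v * norm v) \<le> \<mu>"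
      by (simp add: linear_scale[OF lin] \<mu>_def)
    then show ?thesis using False
      by (simp add: dot_square_norm divide_le_eq power2_eq_square)
  qed
  define r where "r = \<mu> *\<^sub>R u - L u"
  define b where "b = \<mu> * inner r r - inner (L r) r"
  have rS: "r \<in> S" unfolding r_def
    by (intro subspace_diff[OF S] subspace_scale[OF S] uS inv)
  have b0: "b \<ge> 0" using le[OF rS] by (simp add: b_def)
  have quad: "0 \<le> t * t * b - 2 * t * inner r r" for t
  proof -
    define v where "v = u - t *\<^sub>R r"
    have "v \<in> S" unfolding v_def
      by (intro subspace_diff[OF S] subspace_scale[OF S] uS rS)
    hence "inner (L v) v \<le> \<mu> * inner v v" by (rule le)
    moreover have "inner (L r) u = inner (L u) r"
      using adj[of r u] by (simp add: inner_commute)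
    hence "inner (L v) v = \<mu> - 2 * (t * inner (L u) r) + t * t * inner (L r) r"
      by (simp add: v_def \<mu>_def linear_diff[OF lin] linear_scale[OF lin] inner_diff_left
          inner_diff_right algebra_simps)
    moreover have "\<mu> * inner v v = \<mu> - 2 * (\<mu> * (t * inner u r)) + t * t * (\<mu> * inner r r)"
      by (simp add: v_def inner_diff_left inner_diff_right inner_commute[of r u] u1 algebra_simps)
    moreover have "inner r r = \<mu> * inner u r - inner (L u) r"
      using inner_diff_left[of "\<mu> *\<^sub>R u" "L u" r] by (simp flip: r_def)
    hence "t * inner r r = \<mu> * (t * inner u r) - t * inner (L u) r"
      by (simp add: right_diff_distrib)
    moreover have "t * t * b = t * t * (\<mu> * inner r r) - t * t * inner (L r) r"
      by (simp add: b_def right_diff_distrib)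
    ultimately show ?thesis by linarith
  qed
  have "r = 0"
  proof (rule ccontr)
    assume "r \<noteq> 0"
    hence p: "inner r r > 0" by simp
    \<comment> \<open>A step this small makes the linear term of the variation dominate the quadratic one; the \<open>1\<close> in the
      denominator covers the case \<open>b = 0\<close>.\<close>
    define t where "t = inner r r / (b + 1)"
    have t: "t > 0" "t * b \<le> inner r r" using p b0 by (simp_all add: t_def field_simps)
    have "0 \<le> t * (t * b - 2 * inner r r)"
      using quad[of t] by (simp add: algebra_simps)
    hence "2 * inner r r \<le> t * b"
      using t(1) by (simp add: zero_le_mult_iff)
    also note t(2)
    finally show False using p by simp
  qed
  moreover have "u \<noteq> 0" using u1 by force
  ultimately show ?thesis
    using that[of u \<mu>] uS by (simp add: r_def)
qed

text \<open>The part of \<open>S\<close> orthogonal to all eigenvectors is invariant. If it were nonzero it would contain an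
eigenvector, orthogonal to itself. Collecting the summands by eigenvalue allows the components to
be indexed by the eigenvalues.\<close>

lemma selfadjoint_eigendecomposition:
  fixes L :: "'a::euclidean_space \<Rightarrow> 'a"
  assumes lin: "linear L" and adj: "\<And>u v. inner (L u) v = inner u (L v)"
    and S: "subspace S" and inv: "\<And>v. v \<in> S \<Longrightarrow> L v \<in> S" and v: "v \<in> S"
  obtains M g where "finite M" "\<And>\<mu>. \<mu> \<in> M \<Longrightarrow> g \<mu> \<in> S \<and> L (g \<mu>) = \<mu> *\<^sub>R g \<mu>"
    "v = (\<Sum>\<mu>\<in>M. g \<mu>)"
proof -
  define E where "E = {u \<in> S. \<exists>\<mu>. L u = \<mu> *\<^sub>R u}"
  have ES: "span E \<subseteq> S"
    by (rule span_minimal[OF _ S]) (auto simp: E_def)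
  have "v \<in> span E"
  proof (rule ccontr)
    assume nv: "v \<notin> span E"
    obtain y z where y: "y \<in> span E" and z: "\<And>w. w \<in> span E \<Longrightarrow> orthogonal z w" and vyz: "v = y + z"
      using orthogonal_subspace_decomp_exists[of E v] by blast
    let ?S' = "S \<inter> {w. \<forall>u\<in>E. inner u w = 0}"
    have "subspace ?S'"
      using S by (auto simp: subspace_def inner_add_right)
    moreover have "L w \<in> ?S'" if "w \<in> ?S'" for w
    proof -
      have "inner u (L w) = 0" if "u \<in> E" for u
      proof -
        obtain \<mu> where "L u = \<mu> *\<^sub>R u" using \<open>u \<in> E\<close> by (auto simp: E_def)
        moreover have "inner u w = 0" using \<open>w \<in> ?S'\<close> \<open>u \<in> E\<close> by blast
        ultimately show ?thesis using adj[of u w] by simp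
      qed
      thus ?thesis using that inv by auto
    qed
    moreover have "z \<in> ?S'"
    proof -
      have "z = v - y" using vyz by simp
      hence "z \<in> S" using v y ES subspace_diff[OF S] by blast
      thus ?thesis using z[OF span_base] by (auto simp: orthogonal_def inner_commute)
    qed
    moreover have "z \<noteq> 0" using nv y vyz by auto
    ultimately obtain u \<mu> where u: "u \<in> ?S'" "u \<noteq> 0" "L u = \<mu> *\<^sub>R u"
      by (rule selfadjoint_has_eigenvector[OF lin adj])
    hence "u \<in> E" by (auto simp: E_def)
    hence "inner u u = 0" using u by blast
    thus False using u by simp
  qed
  hence "\<exists>M g. finite M \<and> (\<forall>\<mu>\<in>M. g \<mu> \<in> S \<and> L (g \<mu>) = \<mu> *\<^sub>R g \<mu>) \<and> v = (\<Sum>\<mu>\<in>M. g \<mu>)"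
  proof (induction v rule: span_induct_alt)
    case base
    show ?case by (rule exI[of _ "{}"]) simp
  next
    case (step c u y)
    then obtain M g where M: "finite M" "\<forall>\<mu>\<in>M. g \<mu> \<in> S \<and> L (g \<mu>) = \<mu> *\<^sub>R g \<mu>"
      and y: "y = (\<Sum>\<mu>\<in>M. g \<mu>)" by blast
    from step obtain \<kappa> where uS: "u \<in> S" and \<kappa>: "L u = \<kappa> *\<^sub>R u" by (auto simp: E_def)
    define w where "w = (if \<kappa> \<in> M then g \<kappa> else 0)"
    define h where "h = g(\<kappa> := c *\<^sub>R u + w)"
    have w: "w \<in> S" "L w = \<kappa> *\<^sub>R w"
      using M S by (auto simp: w_def subspace_0 linear_0[OF lin])
    have "c *\<^sub>R u + y = c *\<^sub>R u + w + (\<Sum>\<mu>\<in>M - {\<kappa>}. g \<mu>)"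
      using M by (simp add: w_def y sum.remove)
    also have "\<dots> = (\<Sum>\<mu>\<in>insert \<kappa> M. h \<mu>)"
      using M by (simp add: sum.insert_remove h_def)
    finally have "c *\<^sub>R u + y = (\<Sum>\<mu>\<in>insert \<kappa> M. h \<mu>)" .
    moreover have "\<forall>\<mu>\<in>insert \<kappa> M. h \<mu> \<in> S \<and> L (h \<mu>) = \<mu> *\<^sub>R h \<mu>"
      using M uS \<kappa> w
      by (auto simp: h_def linear_add[OF lin] linear_scale[OF lin] scaleR_add_right
          intro!: subspace_add[OF S] subspace_scale[OF S])
    ultimately show ?case using M by (intro exI[of _ "insert \<kappa> M"] exI[of _ h]) simp
  qed
  with that show ?thesis by blast
qed

section \<open>Powers and spectral idempotents\<close>

context euclidean_jordan_algebra
begin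

lemma linear_jprod: "linear (\<lambda>y. x \<odot> y)"
  using bilinear by (simp add: bilinear_def)

lemmas jprod_simps =
  bilinear_ladd[OF bilinear] bilinear_radd[OF bilinear]
  bilinear_lsub[OF bilinear] bilinear_rsub[OF bilinear]
  bilinear_lmul[OF bilinear] bilinear_rmul[OF bilinear]
  bilinear_lzero[OF bilinear] bilinear_rzero[OF bilinear]

lemma jprod_sum_right: "x \<odot> sum f A = (\<Sum>a\<in>A. x \<odot> f a)"
  using linear_sum[OF linear_jprod] .

lemma jprod_sum_left: "sum f A \<odot> x = (\<Sum>a\<in>A. f a \<odot> x)"
  using jprod_sum_right commute by simp

lemma right_unit: "x \<odot> e = x"
  by (simp add: commute[of x] left_unit)

lemma jprod_selfadjoint: "inner (x \<odot> y) z = inner y (x \<odot> z)"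
  by (metis commute inner_assoc)

text \<open>The part of the Jordan identity for \<open>x + t z\<close> that is linear in \<open>t\<close>. The difference of the
identities for \<open>x + z\<close> and \<open>x - z\<close> keeps the parts of odd degree in \<open>z\<close>, and the cubic part is the
identity for \<open>z\<close> itself.\<close>

lemma linearized_jordan_identity:
  "(x \<odot> x \<odot> y) \<odot> z + 2 *\<^sub>R (x \<odot> (y \<odot> (x \<odot> z)))
     = 2 *\<^sub>R ((x \<odot> y) \<odot> (x \<odot> z)) + (x \<odot> x) \<odot> (y \<odot> z)"
proof -
  have 1: "(x + z) \<odot> (((x + z) \<odot> (x + z)) \<odot> y) = ((x + z) \<odot> (x + z)) \<odot> ((x + z) \<odot> y)"
    and 2: "(x - z) \<odot> (((x - z) \<odot> (x - z)) \<odot> y) = ((x - z) \<odot> (x - z)) \<odot> ((x - z) \<odot> y)"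
    and 3: "z \<odot> ((z \<odot> z) \<odot> y) = (z \<odot> z) \<odot> (z \<odot> y)"
    by (rule jordan_identity)+
  have c: "z \<odot> x = x \<odot> z" "y \<odot> z = z \<odot> y" "y \<odot> (x \<odot> z) = (x \<odot> z) \<odot> y"
    "(x \<odot> x \<odot> y) \<odot> z = z \<odot> (x \<odot> x \<odot> y)" "(x \<odot> y) \<odot> (x \<odot> z) = (x \<odot> z) \<odot> (x \<odot> y)"
    by (rule commute)+
  define A B C D where "A = z \<odot> (x \<odot> x \<odot> y)" and "B = x \<odot> ((x \<odot> z) \<odot> y)"
    and "C = (x \<odot> z) \<odot> (x \<odot> y)" and "D = (x \<odot> x) \<odot> (z \<odot> y)"
  have "2 *\<^sub>R (A + 2 *\<^sub>R B) + 2 *\<^sub>R (z \<odot> ((z \<odot> z) \<odot> y))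
      = 2 *\<^sub>R (2 *\<^sub>R C + D) + 2 *\<^sub>R ((z \<odot> z) \<odot> (z \<odot> y))"
  proof -
    from 1 2 have "(x + z) \<odot> (((x + z) \<odot> (x + z)) \<odot> y) - (x - z) \<odot> (((x - z) \<odot> (x - z)) \<odot> y)
     = ((x + z) \<odot> (x + z)) \<odot> ((x + z) \<odot> y) - ((x - z) \<odot> (x - z)) \<odot> ((x - z) \<odot> y)" by simp
    thus ?thesis unfolding jprod_simps c A_def B_def C_def D_def
      by (simp add: algebra_simps scaleR_2)
  qed
  hence "A + 2 *\<^sub>R B = 2 *\<^sub>R C + D" unfolding 3 by simp
  thus ?thesis unfolding c A_def B_def C_def D_def by simp
qed

abbreviation pw :: "'a \<Rightarrow> nat \<Rightarrow> 'a" where "pw \<equiv> jpower (\<odot>) e"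

text \<open>With \<open>L\<^sub>a\<close> for multiplication by \<open>a\<close>, the linearized identity for \<open>y = x\<^sup>m\<close> expresses the
multiplication operator of \<open>x\<^sup>m\<^sup>+\<^sup>2\<close> through \<open>L\<^sub>x\<close>, those of \<open>x\<^sup>2\<close>, \<open>x\<^sup>m\<close> and \<open>x\<^sup>m\<^sup>+\<^sup>1\<close>. All of
these commute with \<open>L\<^sub>x\<close>, the last two by induction and that of \<open>x\<^sup>2\<close> by the Jordan identity.\<close>

lemma power_commutes: "pw x k \<odot> (x \<odot> z) = x \<odot> (pw x k \<odot> z)"
proof (induction k arbitrary: z rule: less_induct)
  case (less k)
  consider "k = 0" | "k = 1" | m where "k = Suc (Suc m)" by (metis One_nat_def nat.exhaust)
  then show ?case
  proof cases
    case 3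
    have IH0: "pw x m \<odot> (x \<odot> z) = x \<odot> (pw x m \<odot> z)" 
      and IH1: "(x \<odot> pw x m) \<odot> (x \<odot> z) = x \<odot> ((x \<odot> pw x m) \<odot> z)" for z
      using less.IH[of m] less.IH[of "Suc m"] 3 by simp_all
    have sq: "(x \<odot> x) \<odot> (x \<odot> z) = x \<odot> ((x \<odot> x) \<odot> z)" for z
      by (rule jordan_identity[symmetric])
    have "pw x k = x \<odot> x \<odot> pw x m"
      using jordan_identity[of x] 3 IH0[of x] IH1 by (metis IH0 commute jpower.simps(2))
    moreover have "(x \<odot> x \<odot> pw x m) \<odot> z = 2 *\<^sub>R ((x \<odot> pw x m) \<odot> (x \<odot> z))
        + (x \<odot> x) \<odot> (pw x m \<odot> z) - 2 *\<^sub>R (x \<odot> (pw x m \<odot> (x \<odot> z)))" for z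
      using linearized_jordan_identity[of x "pw x m" z] by (simp add: algebra_simps)
    ultimately show ?thesis
      by (simp add: jprod_simps IH0 IH1 sq)
  qed (simp_all add: left_unit right_unit)
qed

definition resolution_of_unit :: "'a set \<Rightarrow> bool" where
  "resolution_of_unit C \<longleftrightarrow> finite C \<and> (\<forall>c\<in>C. c \<noteq> 0 \<and> c \<odot> c = c) \<and>
     (\<forall>a\<in>C. \<forall>b\<in>C. a \<noteq> b \<longrightarrow> a \<odot> b = 0) \<and> \<Sum>C = e"

text \<open>Let \<open>e = \<Sum> g\<^sub>\<mu>\<close> be the decomposition into eigenvectors of multiplication by \<open>x\<close> within the span
of the powers of \<open>x\<close>. Multiplication by each \<open>g\<^sub>\<mu>\<close> commutes with multiplication by \<open>x\<close>, so
\<open>\<mu> (g\<^sub>\<mu> g\<^sub>\<nu>) = \<nu> (g\<^sub>\<mu> g\<^sub>\<nu>)\<close>, and products for different eigenvalues vanish. Multiplying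
\<open>e = \<Sum> g\<^sub>\<nu>\<close> by \<open>g\<^sub>\<mu>\<close> then leaves \<open>g\<^sub>\<mu> = g\<^sub>\<mu>\<^sup>2\<close>.\<close>

lemma spectral_idempotents:
  "\<exists>C f. resolution_of_unit C \<and> x = (\<Sum>c\<in>C. f c *\<^sub>R c)"
proof -
  define S where "S = span (range (pw x))"
  have comm: "a \<odot> (x \<odot> z) = x \<odot> (a \<odot> z)" if "a \<in> S" for a z
    using that unfolding S_def
    by (induction a rule: span_induct_alt) (auto simp: jprod_simps power_commutes)
  have "x \<odot> a \<in> S" if "a \<in> S" for a
    using that unfolding S_def
  proof (induction a rule: span_induct_alt)
    case (step c u y)
    then obtain k where "u = pw x k" by blast
    hence "x \<odot> u = pw x (Suc k)" by simp
    hence "x \<odot> u \<in> span (range (pw x))" by (metis rangeI span_base)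
    with step show ?case by (simp add: jprod_simps span_add span_scale)
  qed (simp add: jprod_simps span_zero)
  moreover have "e \<in> S"
    unfolding S_def by (metis jpower.simps(1) rangeI span_base)
  ultimately obtain M g where M: "finite M"
    and g: "\<And>\<mu>. \<mu> \<in> M \<Longrightarrow> g \<mu> \<in> S \<and> x \<odot> g \<mu> = \<mu> *\<^sub>R g \<mu>" and eg: "e = (\<Sum>\<mu>\<in>M. g \<mu>)"
    using selfadjoint_eigendecomposition[OF linear_jprod[of x] jprod_selfadjoint, of S e]
    by (metis S_def subspace_span)
  have orth: "g \<mu> \<odot> g \<nu> = 0" if "\<mu> \<in> M" "\<nu> \<in> M" "\<mu> \<noteq> \<nu>" for \<mu> \<nu>
  proof -
    have "\<mu> *\<^sub>R (g \<mu> \<odot> g \<nu>) = g \<nu> \<odot> (x \<odot> g \<mu>)"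
      using g that by (simp add: jprod_simps commute)
    also have "\<dots> = x \<odot> (g \<nu> \<odot> g \<mu>)" using comm g that by blast
    also have "\<dots> = x \<odot> (g \<mu> \<odot> g \<nu>)" by (simp add: commute)
    also have "\<dots> = g \<mu> \<odot> (x \<odot> g \<nu>)" using comm g that by metis
    also have "\<dots> = \<nu> *\<^sub>R (g \<mu> \<odot> g \<nu>)" using g that by (simp add: jprod_simps)
    finally show ?thesis using that by simp
  qed
  have idem: "g \<mu> \<odot> g \<mu> = g \<mu>" if "\<mu> \<in> M" for \<mu>
  proof -
    have "g \<mu> = g \<mu> \<odot> e" by (simp add: right_unit)
    also have "\<dots> = (\<Sum>\<nu>\<in>M. g \<mu> \<odot> g \<nu>)" by (simp add: eg jprod_sum_right)
    also have "\<dots> = (\<Sum>\<nu>\<in>M. if \<nu> = \<mu> then g \<mu> \<odot> g \<mu> else 0)"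
      using orth that by (intro sum.cong) auto
    finally show ?thesis using M that by simp
  qed
  define M' where "M' = {\<mu> \<in> M. g \<mu> \<noteq> 0}"
  have inj: "inj_on g M'"
    unfolding inj_on_def M'_def using orth idem by force
  have sub: "finite M'" "M' \<subseteq> M" using M by (auto simp: M'_def)
  have "\<Sum>(g ` M') = e"
  proof -
    have "\<Sum>(g ` M') = (\<Sum>\<mu>\<in>M'. g \<mu>)" by (simp add: sum.reindex[OF inj])
    also have "\<dots> = e" unfolding eg by (rule sum.mono_neutral_left) (auto simp: M M'_def)
    finally show ?thesis .
  qed
  moreover have "x = (\<Sum>c\<in>g ` M'. inv_into M' g c *\<^sub>R c)"
  proof -
    have "x = x \<odot> e" by (simp add: right_unit)
    also have "\<dots> = (\<Sum>\<mu>\<in>M. \<mu> *\<^sub>R g \<mu>)" by (simp add: eg jprod_sum_right g)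
    also have "\<dots> = (\<Sum>\<mu>\<in>M'. \<mu> *\<^sub>R g \<mu>)"
      by (rule sum.mono_neutral_right) (auto simp: M M'_def)
    also have "\<dots> = (\<Sum>c\<in>g ` M'. inv_into M' g c *\<^sub>R c)"
      by (simp add: sum.reindex[OF inj] inv_into_f_f[OF inj])
    finally show ?thesis .
  qed
  moreover have "c \<noteq> 0 \<and> c \<odot> c = c" if "c \<in> g ` M'" for c
    using that idem by (auto simp: M'_def)
  moreover have "a \<odot> b = 0" if "a \<in> g ` M'" "b \<in> g ` M'" "a \<noteq> b" for a b
    using that orth sub by blast
  ultimately show ?thesis
    unfolding resolution_of_unit_def using sub
    by (intro exI[of _ "g ` M'"] exI[of _ "inv_into M' g"]) blast
qed

section \<open>Refinement to primitive idempotents\<close>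

text \<open>Multiplication by an idempotent satisfies \<open>2 L\<^sup>3 - 3 L\<^sup>2 + L = 0\<close>, by the linearized Jordan
identity; its eigenvalues are among \<open>0\<close>, \<open>1/2\<close> and \<open>1\<close>. The right-hand side comes from
\<open>s = s\<^sup>2 + 4 (s - s\<^sup>2)\<^sup>2\<close>, which holds at these three points. It shows that \<open>L\<close> is positive
semidefinite and that \<open>\<langle>L v, v\<rangle> = 0\<close> forces \<open>L v = 0\<close>.\<close>

lemma idempotent_quadratic_form:
  assumes c: "c \<odot> c = c"
  shows "inner (c \<odot> v) v = (norm (c \<odot> v))\<^sup>2 + 4 * (norm (c \<odot> v - c \<odot> (c \<odot> v)))\<^sup>2"
proof -
  define a b d where "a = c \<odot> v" and "b = c \<odot> a" and "d = c \<odot> b"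
  have "a + 2 *\<^sub>R d = 2 *\<^sub>R b + b"
    using linearized_jordan_identity[of c c v] by (simp add: c a_def b_def d_def)
  hence "2 *\<^sub>R d = 3 *\<^sub>R b - a"
    by (simp add: scaleR_2 algebra_simps) (simp add: scaleR_left_distrib[of 2 1 b, simplified] scaleR_2)
  hence cubic: "2 * inner d w = 3 * inner b w - inner a w" for w
    by (metis inner_diff_left inner_scaleR_left)
  have ip: "inner b v = inner a a" "inner d v = inner a b" "inner d a = inner b b"
    by (simp_all add: a_def b_def d_def jprod_selfadjoint)
  have "2 * inner a b = 3 * inner a a - inner a v" "2 * inner b b = 3 * inner a b - inner a a"
    using cubic[of v] cubic[of a] ip by (simp_all add: inner_commute)
  thus ?thesis
    by (simp flip: a_def b_def add: dot_square_norm[symmetric] inner_diff_left inner_diff_right inner_commute[of b a])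
qed

lemma idempotents_inner_nonneg:
  assumes "c \<odot> c = c" "d \<odot> d = d"
  shows "0 \<le> inner c d"
proof -
  have "inner c d = inner (c \<odot> d) d" by (metis assms(2) inner_assoc)
  thus ?thesis using idempotent_quadratic_form[OF assms(1), of d] by simp
qed

lemma idempotents_orthogonal:
  assumes "c \<odot> c = c" "d \<odot> d = d" "inner c d = 0"
  shows "c \<odot> d = 0"
proof -
  have "inner (c \<odot> d) d = 0" by (metis assms(2,3) inner_assoc)
  hence "(norm (c \<odot> d))\<^sup>2 + 4 * (norm (c \<odot> d - c \<odot> (c \<odot> d)))\<^sup>2 = 0"
    using idempotent_quadratic_form[OF assms(1), of d] by simp
  thus ?thesis by (simp add: add_nonneg_eq_0_iff)
qed

lemma idempotent_inner_eq_0: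
  assumes "c \<odot> c = c" "c \<odot> d = 0"
  shows "inner c d = 0"
  using inner_assoc[of c c d] assms by simp

text \<open>Passing from \<open>a + b\<close> to its summands keeps orthogonality to \<open>d\<close>, because \<open>\<langle>a, d\<rangle>\<close> and \<open>\<langle>b, d\<rangle>\<close>
are nonnegative with sum zero. This is what permits splitting one member of an orthogonal system.\<close>

lemma summand_orthogonal:
  assumes a: "a \<odot> a = a" and b: "b \<odot> b = b" and d: "d \<odot> d = d" and "(a + b) \<odot> d = 0"
  shows "a \<odot> d = 0"
proof -
  have "inner d (a + b) = 0"
    using idempotent_inner_eq_0[OF d] assms(4) commute by metis
  hence "inner a d + inner b d = 0" by (simp add: inner_add_right inner_commute)
  hence "inner a d = 0"
    using idempotents_inner_nonneg[OF a d] idempotents_inner_nonneg[OF b d] by linarith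
  thus ?thesis by (rule idempotents_orthogonal[OF a d])
qed

text \<open>Among the resolutions of the unit in which \<open>x\<close> is diagonal, one of maximal cardinality exists since
orthogonal nonzero vectors are independent. Splitting a member that is not primitive would give a
larger resolution, with the coefficient of the member repeated on both of its parts.\<close>

lemma primitive_spectral_idempotents:
  "\<exists>C f. resolution_of_unit C \<and> (\<forall>c\<in>C. primitive_idempotent (\<odot>) c) \<and> x = (\<Sum>c\<in>C. f c *\<^sub>R c)"
proof -
  define P where "P C \<longleftrightarrow> resolution_of_unit C \<and> (\<exists>f. x = (\<Sum>c\<in>C. f c *\<^sub>R c))" for C
  obtain C0 where "P C0"
    using spectral_idempotents[of x] unfolding P_def by blast
  moreover have "card C < Suc DIM('a)" if "P C" for C
  proof -
    have "pairwise orthogonal C"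
      using that idempotent_inner_eq_0
      unfolding P_def resolution_of_unit_def pairwise_def orthogonal_def by blast
    moreover have "0 \<notin> C" using that unfolding P_def resolution_of_unit_def by blast
    ultimately have "independent C" by (rule pairwise_orthogonal_independent)
    thus ?thesis using independent_bound[of C] by (simp add: less_Suc_eq_le)
  qed
  ultimately obtain C where C: "P C" and Cmax: "\<And>C'. P C' \<Longrightarrow> card C' \<le> card C"
    using ex_has_greatest_nat[of P C0 card] by (metis less_imp_le_nat)
  obtain f where fin: "finite C" and idem: "\<And>c. c \<in> C \<Longrightarrow> c \<noteq> 0 \<and> c \<odot> c = c"
    and orth: "\<And>a b. a \<in> C \<Longrightarrow> b \<in> C \<Longrightarrow> a \<noteq> b \<Longrightarrow> a \<odot> b = 0"
    and sum: "\<Sum>C = e" and x: "x = (\<Sum>c\<in>C. f c *\<^sub>R c)"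
    using C unfolding P_def resolution_of_unit_def by blast
  have "primitive_idempotent (\<odot>) c" if c: "c \<in> C" for c
  proof (rule ccontr)
    assume "\<not> primitive_idempotent (\<odot>) c"
    then obtain a b where a: "a \<odot> a = a" "a \<noteq> 0" and b: "b \<odot> b = b" "b \<noteq> 0"
      and ab: "a \<odot> b = 0" "c = a + b"
      using idem[OF c] unfolding primitive_idempotent_def idempotent_def by blast
    define D where "D = C - {c}"
    have D: "a \<odot> d = 0 \<and> b \<odot> d = 0 \<and> d \<odot> a = 0 \<and> d \<odot> b = 0 \<and> d \<odot> d = d \<and> d \<noteq> 0"
      if "d \<in> D" for d
    proof -
      have d: "d \<odot> d = d" "d \<noteq> 0" "(a + b) \<odot> d = 0" "(b + a) \<odot> d = 0"
        using idem orth[OF c] that ab(2) by (auto simp: D_def add.commute)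
      have "a \<odot> d = 0" "b \<odot> d = 0"
        using summand_orthogonal[OF a(1) b(1) d(1,3)] summand_orthogonal[OF b(1) a(1) d(1,4)] .
      thus ?thesis using d commute by metis
    qed
    have neq: "a \<noteq> b" "a \<notin> D" "b \<notin> D"
      using a b ab(1) D[of a] D[of b] by auto
    have finD: "finite D" using fin by (simp add: D_def)
    define g where "g = f(a := f c, b := f c)"
    have "(\<Sum>d\<in>D. g d *\<^sub>R d) = (\<Sum>d\<in>D. f d *\<^sub>R d)"
      using neq by (intro sum.cong) (auto simp: g_def)
    hence "(\<Sum>d\<in>insert a (insert b D). g d *\<^sub>R d) = x"
      using neq finD c fin unfolding x
      by (simp add: g_def ab(2) scaleR_add_right sum.remove[of C c] D_def)
    moreover have "\<Sum>(insert a (insert b D)) = e"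
      using neq finD c fin unfolding sum[symmetric]
      by (simp add: ab(2) sum.remove[of C c] D_def)
    moreover have "\<forall>u\<in>insert a (insert b D). u \<noteq> 0 \<and> u \<odot> u = u"
      using a b D by auto
    moreover have "\<forall>u\<in>insert a (insert b D). \<forall>v\<in>insert a (insert b D). u \<noteq> v \<longrightarrow> u \<odot> v = 0"
      using a b ab D orth by (auto simp: commute[of b a]) (auto simp: D_def)
    ultimately have "P (insert a (insert b D))"
      using finD unfolding P_def resolution_of_unit_def by blast
    hence "card (insert a (insert b D)) \<le> card C" by (rule Cmax)
    moreover have "Suc (card D) = card C" using card_Suc_Diff1[OF fin c] by (simp add: D_def)
    moreover have "card (insert a (insert b D)) = Suc (Suc (card D))"
      using neq finD by (simp add: card_insert_disjoint)
    ultimately show False by linarith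
  qed
  with C x show ?thesis unfolding P_def by blast
qed

lemma spectral_decomposition_exists:
  "\<exists>xs es. sorted_wrt (\<ge>) xs \<and> spectral_decomposition (\<odot>) e x xs es"
proof -
  obtain C f where res: "resolution_of_unit C" and prim: "\<forall>c\<in>C. primitive_idempotent (\<odot>) c"
    and x: "x = (\<Sum>c\<in>C. f c *\<^sub>R c)"
    using primitive_spectral_idempotents[of x] by blast
  have C: "finite C" "\<forall>a\<in>C. \<forall>b\<in>C. a \<noteq> b \<longrightarrow> a \<odot> b = 0" "\<Sum>C = e"
    using res by (simp_all add: resolution_of_unit_def)
  obtain cs where cs: "set cs = C" "distinct cs" using finite_distinct_list[OF C(1)] by blast
  define es where "es = rev (sort_key f cs)"
  have es: "set es = C" "distinct es" using cs by (auto simp: es_def)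
  have "sorted_wrt (\<ge>) (map f es)"
    by (simp add: es_def sorted_wrt_rev flip: rev_map)
  moreover have "sum_list es = e"
    using es C(3) sum_list_distinct_conv_sum_set[OF es(2), of "\<lambda>c. c"] by simp
  moreover have "x = (\<Sum>i<length es. map f es ! i *\<^sub>R es ! i)"
    using es x sum_list_distinct_conv_sum_set[OF es(2), of "\<lambda>c. f c *\<^sub>R c"]
    by (simp add: sum_list_sum_nth atLeast0LessThan)
  moreover have "es ! i \<odot> es ! j = 0" if "i < length es" "j < length es" "i \<noteq> j" for i j
  proof -
    have "es ! i \<in> C" "es ! j \<in> C" "es ! i \<noteq> es ! j"
      using that es by (auto simp: nth_eq_iff_index_eq)
    thus ?thesis using C(2) by blast
  qed
  ultimately have "sorted_wrt (\<ge>) (map f es) \<and> spectral_decomposition (\<odot>) e x (map f es) es"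
    using es(1) prim unfolding spectral_decomposition_def jordan_frame_def by simp
  thus ?thesis by blast
qed

abbreviation eig :: "'a \<Rightarrow> real list" where "eig \<equiv> eigvals (\<odot>) e"

lemma eig_sorted_decomposition:
  "sorted_wrt (\<ge>) (eig x) \<and> (\<exists>es. spectral_decomposition (\<odot>) e x (eig x) es)"
proof -
  have "\<exists>xs. sorted_wrt (\<ge>) xs \<and> (\<exists>es. spectral_decomposition (\<odot>) e x xs es)"
    using spectral_decomposition_exists by blast
  thus ?thesis unfolding eigvals_def by (rule someI_ex)
qed

lemmas eig_sorted = eig_sorted_decomposition[THEN conjunct1]
  and eig_decomposition = eig_sorted_decomposition[THEN conjunct2]

section \<open>Calculation in a Jordan frame\<close>

context
  fixes es assumes frame: "jordan_frame (\<odot>) e es"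
begin

lemma frame_idempotent: "i < length es \<Longrightarrow> es ! i \<odot> es ! i = es ! i"
  and frame_nonzero: "i < length es \<Longrightarrow> es ! i \<noteq> 0"
  and frame_orthogonal: "i < length es \<Longrightarrow> j < length es \<Longrightarrow> i \<noteq> j \<Longrightarrow> es ! i \<odot> es ! j = 0"
  and frame_sum: "(\<Sum>i<length es. es ! i) = e"
proof -
  have prim: "\<forall>c\<in>set es. c \<odot> c = c \<and> c \<noteq> 0"
    using frame unfolding jordan_frame_def primitive_idempotent_def idempotent_def by blast
  show "i < length es \<Longrightarrow> es ! i \<odot> es ! i = es ! i" "i < length es \<Longrightarrow> es ! i \<noteq> 0"
    using prim nth_mem by blast+
  show "i < length es \<Longrightarrow> j < length es \<Longrightarrow> i \<noteq> j \<Longrightarrow> es ! i \<odot> es ! j = 0"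
    using frame unfolding jordan_frame_def by blast
  show "(\<Sum>i<length es. es ! i) = e"
    using frame by (simp add: jordan_frame_def sum_list_sum_nth atLeast0LessThan)
qed

lemma frame_combination:
  assumes "j < length es"
  shows "(\<Sum>i<length es. a i *\<^sub>R es ! i) \<odot> es ! j = a j *\<^sub>R es ! j"
proof -
  have "(\<Sum>i<length es. a i *\<^sub>R es ! i) \<odot> es ! j
      = (\<Sum>i<length es. if i = j then a j *\<^sub>R es ! j else 0)"
    unfolding jprod_sum_left using assms
    by (intro sum.cong) (auto simp: jprod_simps frame_idempotent frame_orthogonal)
  thus ?thesis using assms by simp
qed

lemma frame_combination_product:
  "(\<Sum>i<length es. a i *\<^sub>R es ! i) \<odot> (\<Sum>i<length es. b i *\<^sub>R es ! i)
    = (\<Sum>i<length es. (a i * b i) *\<^sub>R es ! i)"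
  by (simp add: jprod_sum_right jprod_simps frame_combination mult.commute)

lemma frame_combination_inject:
  assumes "(\<Sum>i<length es. a i *\<^sub>R es ! i) = (\<Sum>i<length es. b i *\<^sub>R es ! i)" "j < length es"
  shows "a j = b j"
  using frame_combination[OF assms(2), of a] frame_combination[OF assms(2), of b] 
    frame_nonzero[OF assms(2)] by (simp add: assms(1))

lemma frame_power:
  "pw (\<Sum>i<length es. a i *\<^sub>R es ! i) k = (\<Sum>i<length es. a i ^ k *\<^sub>R es ! i)"
  by (induction k) (simp_all add: frame_sum frame_combination_product)

end

text \<open>The eigenvalues of an idempotent satisfy \<open>s\<^sup>2 = s\<close>. If \<open>j\<close> is an index with eigenvalue \<open>1\<close>, the
remaining part \<open>d\<close> of \<open>c\<close> is an idempotent orthogonal to the \<open>j\<close>-th member of the frame, so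
primitivity forces \<open>d = 0\<close>.\<close>

lemma primitive_eigenvalues:
  assumes prim: "primitive_idempotent (\<odot>) c" and dec: "spectral_decomposition (\<odot>) e c xs es"
  obtains j where "j < length es" "xs = map (\<lambda>i. if i = j then 1 else 0) [0..<length es]"
proof -
  have frame: "jordan_frame (\<odot>) e es" and len: "length xs = length es"
    and c: "c = (\<Sum>i<length es. xs ! i *\<^sub>R es ! i)"
    using dec by (auto simp: spectral_decomposition_def)
  have cc: "c \<odot> c = c" "c \<noteq> 0" using prim by (auto simp: primitive_idempotent_def idempotent_def)
  have xs: "xs ! i * xs ! i = xs ! i" if "i < length es" for i
    using frame_combination_inject[OF frame _ that, of "\<lambda>i. xs ! i * xs ! i" "\<lambda>i. xs ! i"]
      frame_combination_product[OF frame, of "\<lambda>i. xs ! i" "\<lambda>i. xs ! i"] cc(1) by (simp add: c)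
  obtain j where j: "j < length es" "xs ! j \<noteq> 0"
  proof (rule ccontr)
    assume "\<not> thesis"
    hence "\<forall>i<length es. xs ! i = 0" using that by blast
    hence "c = 0" unfolding c by (intro sum.neutral) simp
    thus False using cc(2) by simp
  qed
  have j1: "xs ! j = 1" using xs[OF j(1)] j(2) by simp
  define d where "d = (\<Sum>i<length es. (if i = j then 0 else xs ! i) *\<^sub>R es ! i)"
  have "d = (\<Sum>i\<in>{..<length es} - {j}. xs ! i *\<^sub>R es ! i)"
    unfolding d_def using j(1) by (subst sum.remove[of _ j]) (auto intro!: sum.cong)
  hence "es ! j + d = c"
    using j(1) by (simp add: c j1 sum.remove[of "{..<length es}" j])
  moreover have "d \<odot> d = d"
    unfolding d_def frame_combination_product[OF frame]
    by (intro sum.cong refl arg_cong[where f = "\<lambda>r. r *\<^sub>R _"]) (use xs in auto)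
  moreover have "es ! j \<odot> d = 0"
    using frame_combination[OF frame j(1), of "\<lambda>i. if i = j then 0 else xs ! i"]
    by (simp add: commute[of "es ! j"] d_def)
  ultimately have "d = 0"
    using prim frame_idempotent[OF frame j(1)] frame_nonzero[OF frame j(1)]
    unfolding primitive_idempotent_def idempotent_def by blast
  hence "xs ! i = 0" if "i < length es" "i \<noteq> j" for i
    using frame_combination_inject[OF frame _ that(1), of "\<lambda>i. if i = j then 0 else xs ! i" "\<lambda>i. 0"] that
    by (simp add: d_def)
  hence "xs = map (\<lambda>i. if i = j then 1 else 0) [0..<length es]"
    using j1 len by (intro nth_equalityI) auto
  with that j show ?thesis by blast
qed

lemma unit_nonzero: "e \<noteq> 0"
proof
  assume "e = 0"
  hence "x = 0" for x :: 'a using left_unit[of x] by (simp add: jprod_simps)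
  thus False using nonempty_Basis nonzero_Basis by blast
qed

lemma spectral_decomposition_scale:
  assumes "spectral_decomposition (\<odot>) e x xs es"
  shows "spectral_decomposition (\<odot>) e (t *\<^sub>R x) (map ((*) t) xs) es"
  using assms by (auto simp: spectral_decomposition_def scaleR_sum_right)

lemma spectral_decomposition_rev:
  assumes "spectral_decomposition (\<odot>) e x xs es"
  shows "spectral_decomposition (\<odot>) e x (rev xs) (rev es)"
proof -
  let ?n = "length es"
  have frame: "jordan_frame (\<odot>) e es" and len: "length xs = ?n"
    and x: "x = (\<Sum>i<?n. xs ! i *\<^sub>R es ! i)"
    using assms by (auto simp: spectral_decomposition_def)
  have "jordan_frame (\<odot>) e (rev es)"
    using frame by (auto simp: jordan_frame_def rev_nth)
  moreover have "(\<Sum>i<?n. rev xs ! i *\<^sub>R rev es ! i) = (\<Sum>i<?n. xs ! (?n - Suc i) *\<^sub>R es ! (?n - Suc i))"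
    using len by (intro sum.cong) (auto simp: rev_nth)
  hence "x = (\<Sum>i<?n. rev xs ! i *\<^sub>R rev es ! i)"
    unfolding x by (simp add: sum.nat_diff_reindex[of "\<lambda>i. xs ! i *\<^sub>R es ! i"])
  ultimately show ?thesis by (simp add: spectral_decomposition_def len)
qed

end

section \<open>Eigenvalues and rank under the trace inner product\<close>

locale trace_jordan_algebra = euclidean_jordan_algebra +
  assumes trace_inner: "carries_trace_inner_product (\<odot>) e"
begin

text \<open>Here \<open>\<langle>c, c\<rangle> = tr(c\<^sup>2) = tr(c)\<close>, the sum of the chosen list of eigenvalues of \<open>c\<close>. This list has a
single entry \<open>1\<close> whichever decomposition was chosen, so uniqueness of eigenvalues is not
presupposed.\<close>

lemma primitive_unit_length:
  assumes "primitive_idempotent (\<odot>) c" shows "inner c c = 1"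
proof -
  have "inner c c = sum_list (eig c)"
    using trace_inner assms
    by (simp add: carries_trace_inner_product_def jtrace_def primitive_idempotent_def idempotent_def)
  moreover obtain es where "spectral_decomposition (\<odot>) e c (eig c) es"
    using eig_decomposition by blast
  then obtain j where "j < length es" "eig c = map (\<lambda>i. if i = j then 1 else 0) [0..<length es]"
    by (rule primitive_eigenvalues[OF assms])
  ultimately show ?thesis by (simp add: interv_sum_list_conv_sum_set_nat)
qed

lemma frame_inner:
  assumes frame: "jordan_frame (\<odot>) e es" and ij: "i < length es" "j < length es"
  shows "inner (es ! i) (es ! j) = (if i = j then 1 else 0)"
proof (cases "i = j")
  case True
  have "primitive_idempotent (\<odot>) (es ! i)"
    using frame ij(1) by (simp add: jordan_frame_def)
  thus ?thesis using True primitive_unit_length by simp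
next
  case False
  thus ?thesis
    using idempotent_inner_eq_0[OF frame_idempotent[OF frame ij(1)] frame_orthogonal[OF frame ij False]]
    by simp
qed

lemma frame_combination_inner:
  assumes "jordan_frame (\<odot>) e es" "j < length es"
  shows "inner (\<Sum>i<length es. a i *\<^sub>R es ! i) (es ! j) = a j"
proof -
  have "inner (\<Sum>i<length es. a i *\<^sub>R es ! i) (es ! j)
      = (\<Sum>i<length es. if i = j then a j else 0)"
    unfolding inner_sum_left using assms by (intro sum.cong) (auto simp: frame_inner)
  thus ?thesis using assms(2) by simp
qed

lemma frame_inner_unit:
  assumes frame: "jordan_frame (\<odot>) e es" and "j < length es"
  shows "inner e (es ! j) = 1"
  using frame_combination_inner[OF assms, of "\<lambda>_. 1"] frame_sum[OF frame] by simp

lemma frame_length: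
  assumes frame: "jordan_frame (\<odot>) e es"
  shows "real (length es) = inner e e"
proof -
  have "inner e e = inner e (\<Sum>i<length es. es ! i)" by (simp add: frame_sum[OF frame])
  also have "\<dots> = (\<Sum>i<length es. 1)"
    unfolding inner_sum_right using frame_inner_unit[OF frame] by (intro sum.cong) auto
  finally show ?thesis by simp
qed

lemma frames_same_length:
  "jordan_frame (\<odot>) e es \<Longrightarrow> jordan_frame (\<odot>) e fs \<Longrightarrow> length es = length fs"
  using frame_length[of es] frame_length[of fs] by simp

lemma sum_list_spectral_decomposition:
  assumes "spectral_decomposition (\<odot>) e x xs es"
  shows "sum_list xs = inner x e"
proof -
  have frame: "jordan_frame (\<odot>) e es" and len: "length xs = length es"
    and x: "x = (\<Sum>i<length es. xs ! i *\<^sub>R es ! i)"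
    using assms by (auto simp: spectral_decomposition_def)
  have "inner x e = (\<Sum>i<length es. xs ! i)"
    unfolding x inner_sum_left
    by (intro sum.cong) (auto simp: frame_inner_unit[OF frame] inner_commute[of _ e])
  thus ?thesis by (simp add: sum_list_sum_nth atLeast0LessThan len)
qed

text \<open>The coefficients of \<open>D x\<close> arise from those of \<open>x\<close> through the matrix \<open>\<langle>D e\<^sub>i, f\<^sub>j\<rangle>\<close>. Its row and
column sums are \<open>\<langle>D e, f\<^sub>j\<rangle>\<close> and \<open>\<langle>D e\<^sub>i, e\<rangle>\<close>, both equal to \<open>1\<close>. Positivity is required only
between the two frames, so that the lemma applies with \<open>D = id\<close> before eigenvalues are known to be
unique.\<close>

lemma spectral_majorization:
  assumes lin: "linear D"
    and x: "spectral_decomposition (\<odot>) e x xs es" "sorted_wrt (\<ge>) xs"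
    and y: "spectral_decomposition (\<odot>) e (D x) ys fs" "sorted_wrt (\<ge>) ys"
    and unit: "D e = e" and trace: "\<And>z. inner (D z) e = inner z e"
    and pos: "\<And>c d. c \<in> set es \<Longrightarrow> d \<in> set fs \<Longrightarrow> 0 \<le> inner (D c) d"
  shows "(ys :: real list) \<prec> xs"
proof -
  have es: "jordan_frame (\<odot>) e es" "length xs = length es"
    and xe: "x = (\<Sum>i<length es. xs ! i *\<^sub>R es ! i)"
    using x by (auto simp: spectral_decomposition_def)
  have fs: "jordan_frame (\<odot>) e fs" "length ys = length fs"
    and yf: "D x = (\<Sum>i<length fs. ys ! i *\<^sub>R fs ! i)"
    using y by (auto simp: spectral_decomposition_def)
  have len: "length fs = length es" using frames_same_length es fs by blast
  show ?thesis
  proof (rule doubly_stochastic_matrix_majorization[OF x(2) y(2) es(2), where A = "\<lambda>j i. inner (D (es ! i)) (fs ! j)"])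
    show "length ys = length es" using fs len by simp
    show "0 \<le> inner (D (es ! i)) (fs ! j)" if "i < length es" "j < length es" for i j
      using that len by (intro pos) simp_all
    show "(\<Sum>i<length es. inner (D (es ! i)) (fs ! j)) = 1" if "j < length es" for j
    proof -
      have "(\<Sum>i<length es. inner (D (es ! i)) (fs ! j)) = inner (D e) (fs ! j)"
        by (simp add: linear_sum[OF lin] inner_sum_left flip: frame_sum[OF es(1)])
      thus ?thesis using frame_inner_unit[OF fs(1)] that len by (simp add: unit)
    qed
    show "(\<Sum>j<length es. inner (D (es ! i)) (fs ! j)) = 1" if "i < length es" for i
    proof -
      have "(\<Sum>j<length es. inner (D (es ! i)) (fs ! j)) = inner (D (es ! i)) e"
        using frame_sum[OF fs(1)] by (simp add: len flip: inner_sum_right)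
      also have "\<dots> = inner e (es ! i)" by (simp add: trace inner_commute[of "es ! i" e])
      finally show ?thesis using frame_inner_unit[OF es(1) that] by simp
    qed
    show "ys ! j = (\<Sum>i<length es. inner (D (es ! i)) (fs ! j) * xs ! i)" if "j < length es" for j
    proof -
      have "ys ! j = inner (D x) (fs ! j)"
        using frame_combination_inner[OF fs(1), of j "\<lambda>i. ys ! i"] that len by (simp add: yf)
      also have "\<dots> = (\<Sum>i<length es. inner (D (es ! i)) (fs ! j) * xs ! i)"
        by (simp add: xe linear_sum[OF lin] linear_scale[OF lin] inner_sum_left mult.commute)
      finally show ?thesis .
    qed
  qed
qed

lemma frame_elements_inner_nonneg:
  assumes "jordan_frame (\<odot>) e es" "jordan_frame (\<odot>) e fs" "c \<in> set es" "d \<in> set fs"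
  shows "0 \<le> inner c d"
  using assms unfolding jordan_frame_def primitive_idempotent_def idempotent_def
  by (intro idempotents_inner_nonneg) blast+

lemma eigvals_unique:
  assumes "spectral_decomposition (\<odot>) e x xs es" "sorted_wrt (\<ge>) xs"
  shows "eig x = xs"
proof -
  obtain fs where fs: "spectral_decomposition (\<odot>) e x (eig x) fs" using eig_decomposition by blast
  have frames: "jordan_frame (\<odot>) e es" "jordan_frame (\<odot>) e fs"
    using assms(1) fs by (auto simp: spectral_decomposition_def)
  have "eig x \<prec> xs"
    by (rule spectral_majorization[where D = "\<lambda>z. z", OF linear_id[unfolded id_def] assms fs eig_sorted])
      (use frame_elements_inner_nonneg[OF frames] in auto)
  moreover have "xs \<prec> eig x"
    by (rule spectral_majorization[where D = "\<lambda>z. z", OF linear_id[unfolded id_def] fs eig_sorted assms])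
      (use frame_elements_inner_nonneg[OF frames(2,1)] in auto)
  ultimately show ?thesis by (rule majorized_by_antisym[OF eig_sorted assms(2)])
qed

text \<open>A negative factor reverses the order of the eigenvalues, hence the formulation with multisets.\<close>

lemma mset_eigvals_scale: "mset (eig (t *\<^sub>R x)) = mset (map ((*) t) (eig x))"
proof -
  obtain es where "spectral_decomposition (\<odot>) e x (eig x) es" using eig_decomposition by blast
  hence dec: "spectral_decomposition (\<odot>) e (t *\<^sub>R x) (map ((*) t) (eig x)) es"
    by (rule spectral_decomposition_scale)
  show ?thesis
  proof (cases "t \<ge> 0")
    case True
    hence "sorted_wrt (\<ge>) (map ((*) t) (eig x))"
      unfolding sorted_wrt_map by (intro sorted_wrt_mono_rel[OF _ eig_sorted]) (simp add: mult_left_mono)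
    from eigvals_unique[OF dec this] show ?thesis by simp
  next
    case False
    hence "sorted_wrt (\<ge>) (rev (map ((*) t) (eig x)))"
      unfolding sorted_wrt_rev sorted_wrt_map
      by (intro sorted_wrt_mono_rel[OF _ eig_sorted]) (simp add: mult_left_mono_neg)
    from eigvals_unique[OF spectral_decomposition_rev[OF dec] this] show ?thesis by simp
  qed
qed

lemma sum_list_eigvals: "sum_list (eig x) = inner x e"
  using eig_decomposition sum_list_spectral_decomposition by blast

lemma constant_eigvals:
  assumes "\<And>l. l \<in> set (eig x) \<Longrightarrow> l = a"
  shows "x = a *\<^sub>R e"
proof -
  obtain es where "spectral_decomposition (\<odot>) e x (eig x) es" using eig_decomposition by blast
  hence frame: "jordan_frame (\<odot>) e es" and len: "length (eig x) = length es"
    and x: "x = (\<Sum>i<length es. eig x ! i *\<^sub>R es ! i)"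
    by (auto simp: spectral_decomposition_def)
  have "x = (\<Sum>i<length es. a *\<^sub>R es ! i)"
    by (subst x, intro sum.cong refl) (use assms len nth_mem in auto)
  thus ?thesis by (simp add: frame_sum[OF frame] flip: scaleR_sum_right)
qed

abbreviation powers_dependent :: "'a \<Rightarrow> nat \<Rightarrow> bool" where
  "powers_dependent x k \<equiv> 0 < k \<and>
     (\<exists>b :: nat \<Rightarrow> real. (\<exists>i\<le>k. b i \<noteq> 0) \<and> (\<Sum>i\<le>k. b i *\<^sub>R pw x i) = 0)"

text \<open>The polynomial with the coefficients \<open>a\<^sub>j\<close> as its roots annihilates the element.\<close>

lemma frame_powers_dependent:
  assumes frame: "jordan_frame (\<odot>) e es"
  shows "powers_dependent (\<Sum>j<length es. a j *\<^sub>R es ! j) (length es)"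
proof -
  let ?n = "length es" and ?x = "\<Sum>j<length es. a j *\<^sub>R es ! j"
  define p where "p = (\<Prod>j<?n. [:- a j, 1:])"
  have deg: "degree p = ?n"
    unfolding p_def by (subst degree_prod_sum_eq) auto
  have "lead_coeff p = 1" unfolding p_def by (simp add: lead_coeff_prod)
  hence "coeff p ?n \<noteq> 0" by (simp add: deg)
  moreover have "(\<Sum>i\<le>?n. coeff p i *\<^sub>R pw ?x i) = 0"
  proof -
    have "(\<Sum>i\<le>?n. coeff p i *\<^sub>R pw ?x i) = (\<Sum>j<?n. poly p (a j) *\<^sub>R es ! j)"
      unfolding frame_power[OF frame] poly_altdef deg
      by (simp add: scaleR_sum_right scaleR_sum_left sum.swap[of _ "{..?n}"])
    also have "\<dots> = 0" by (intro sum.neutral) (auto simp: p_def poly_prod)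
    finally show ?thesis .
  qed
  moreover have "0 < ?n" using frame_sum[OF frame] unit_nonzero by (cases es) auto
  ultimately show ?thesis by blast
qed

text \<open>A relation of degree \<open>k\<close> between the powers is a polynomial of degree at most \<open>k\<close> that vanishes at
all of the distinct numbers \<open>a\<^sub>j\<close>.\<close>

lemma frame_powers_independent:
  assumes frame: "jordan_frame (\<odot>) e es" and inj: "inj_on a {..<length es}"
    and dep: "powers_dependent (\<Sum>j<length es. a j *\<^sub>R es ! j) k"
  shows "length es \<le> k"
proof -
  let ?n = "length es" and ?x = "\<Sum>j<length es. a j *\<^sub>R es ! j"
  from dep obtain b i where b: "i \<le> k" "b i \<noteq> 0" and 0: "(\<Sum>i\<le>k. b i *\<^sub>R pw ?x i) = 0"
    by blast
  have "(\<Sum>j<?n. (\<Sum>i\<le>k. b i * a j ^ i) *\<^sub>R es ! j) = (\<Sum>j<?n. 0 *\<^sub>R es ! j)"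
    using 0 unfolding frame_power[OF frame]
    by (simp add: scaleR_sum_right scaleR_sum_left sum.swap[of _ "{..k}"])
  hence "(\<Sum>i\<le>k. b i * a j ^ i) = 0" if "j < ?n" for j
    using frame_combination_inject[OF frame _ that, of "\<lambda>j. \<Sum>i\<le>k. b i * a j ^ i" "\<lambda>_. 0"] by simp
  hence "a ` {..<?n} \<subseteq> {z. (\<Sum>i\<le>k. b i * z ^ i) = 0}" by auto
  moreover have "finite {z. (\<Sum>i\<le>k. b i * z ^ i) = 0}" "card {z. (\<Sum>i\<le>k. b i * z ^ i) = 0} \<le> k"
    using Poly_Roots.polyfun_rootbound[where c = b and n = k] b by auto
  ultimately have "card (a ` {..<?n}) \<le> k" using card_mono order_trans by blast
  thus ?thesis by (simp add: card_image[OF inj])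
qed

text \<open>No degree exceeds the common length of the frames, and an element with distinct coefficients in a
frame attains it.\<close>

lemma length_frame_eq_rank:
  assumes frame: "jordan_frame (\<odot>) e es"
  shows "length es = jrank (\<odot>) e"
proof -
  have le: "jdegree (\<odot>) e x \<le> length es" for x
  proof -
    obtain fs where "spectral_decomposition (\<odot>) e x (eig x) fs" using eig_decomposition by blast
    hence fs: "jordan_frame (\<odot>) e fs" "x = (\<Sum>i<length fs. eig x ! i *\<^sub>R fs ! i)"
      by (auto simp: spectral_decomposition_def)
    show ?thesis
      using frame_powers_dependent[OF fs(1), of "\<lambda>i. eig x ! i"] frames_same_length[OF frame fs(1)]
      unfolding fs(2)[symmetric] jdegree_def by (intro Least_le) simp
  qed
  \<comment> \<open>The coefficients \<open>0, 1, 2, \<dots>\<close> serve as distinct numbers.\<close>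
  define y where "y = (\<Sum>j<length es. real j *\<^sub>R es ! j)"
  have "powers_dependent y (jdegree (\<odot>) e y)"
    unfolding jdegree_def
    by (rule LeastI[of "powers_dependent y" "length es"]) (simp only: y_def frame_powers_dependent[OF frame])
  hence "length es \<le> jdegree (\<odot>) e y"
    unfolding y_def by (intro frame_powers_independent[OF frame, of real]) (auto simp: inj_on_def)
  hence "jdegree (\<odot>) e y = length es"
    using le[of y] by simp
  hence "length es \<in> range (jdegree (\<odot>) e)" by (metis rangeI)
  moreover have "finite (range (jdegree (\<odot>) e))"
    by (rule finite_subset[OF _ finite_atMost[of "length es"]]) (use le in blast)
  ultimately have "Max (range (jdegree (\<odot>) e)) = length es"
    using le by (intro Max_eqI) blast+
  thus ?thesis by (simp add: jrank_def)
qed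

lemma length_eigvals: "length (eig x) = jrank (\<odot>) e"
  using eig_decomposition[of x] length_frame_eq_rank by (auto simp: spectral_decomposition_def)

section \<open>Doubly stochastic maps\<close>

lemma primitive_in_cone:
  assumes "primitive_idempotent (\<odot>) c"
  shows "c \<in> symmetric_cone (\<odot>) e"
proof -
  obtain es where "spectral_decomposition (\<odot>) e c (eig c) es" using eig_decomposition by blast
  then obtain j where "eig c = map (\<lambda>i. if i = j then 1 else 0) [0..<length es]"
    using primitive_eigenvalues[OF assms] by metis
  thus ?thesis by (auto simp: symmetric_cone_def)
qed

text \<open>One half of the self-duality of the symmetric cone, tested on the idempotents that generate it.\<close>

lemma cone_inner_idempotent:
  assumes x: "x \<in> symmetric_cone (\<odot>) e" and d: "d \<odot> d = d"
  shows "0 \<le> inner x d"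
proof -
  obtain es where "spectral_decomposition (\<odot>) e x (eig x) es" using eig_decomposition by blast
  hence frame: "jordan_frame (\<odot>) e es" and len: "length (eig x) = length es"
    and xe: "x = (\<Sum>i<length es. eig x ! i *\<^sub>R es ! i)"
    by (auto simp: spectral_decomposition_def)
  have "inner x d = (\<Sum>i<length es. eig x ! i * inner (es ! i) d)"
    by (subst xe) (simp add: inner_sum_left)
  also have "\<dots> \<ge> 0"
    using x len d idempotents_inner_nonneg frame_idempotent[OF frame]
    by (intro sum_nonneg mult_nonneg_nonneg) (auto simp: symmetric_cone_def)
  finally show ?thesis .
qed

lemma doubly_stochastic_majorization:
  assumes "doubly_stochastic (\<odot>) e D"
  shows "eig (D x) \<prec> eig x"
proof -
  have lin: "linear D" and cone: "\<And>z. z \<in> symmetric_cone (\<odot>) e \<Longrightarrow> D z \<in> symmetric_cone (\<odot>) e"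
    and unit: "D e = e" and adj: "adjoint D e = e"
    using assms by (auto simp: doubly_stochastic_def)
  obtain es fs where es: "spectral_decomposition (\<odot>) e x (eig x) es"
    and fs: "spectral_decomposition (\<odot>) e (D x) (eig (D x)) fs"
    using eig_decomposition by blast
  show ?thesis
  proof (rule spectral_majorization[OF lin es eig_sorted fs eig_sorted unit])
    show "inner (D z) e = inner z e" for z
      using adjoint_works[OF lin, of z e] by (simp add: adj)
    fix c d assume cd: "c \<in> set es" "d \<in> set fs"
    have "primitive_idempotent (\<odot>) c" "primitive_idempotent (\<odot>) d"
      using es fs cd by (simp_all add: spectral_decomposition_def jordan_frame_def)
    moreover from this(2) have "d \<odot> d = d"
      by (simp add: primitive_idempotent_def idempotent_def)
    ultimately show "0 \<le> inner (D c) d" by (intro cone_inner_idempotent cone primitive_in_cone)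
  qed
qed

lemma eigvals_unit: "l \<in> set (eig e) \<Longrightarrow> l = 1"
proof -
  obtain es where "spectral_decomposition (\<odot>) e e (eig e) es" using eig_decomposition by blast
  hence frame: "jordan_frame (\<odot>) e es" by (simp add: spectral_decomposition_def)
  have "spectral_decomposition (\<odot>) e e (replicate (length es) 1) es"
    using frame by (simp add: spectral_decomposition_def frame_sum)
  hence "eig e = replicate (length es) 1"
    by (rule eigvals_unique) (simp add: sorted_wrt_iff_nth_less)
  thus "l \<in> set (eig e) \<Longrightarrow> l = 1" by simp
qed

lemma doubly_stochastic_if_majorizing:
  assumes lin: "linear D" and maj: "\<And>x. eig (D x) \<prec> eig x"
  shows "doubly_stochastic (\<odot>) e D"
proof -
  have "D x \<in> symmetric_cone (\<odot>) e" if x: "x \<in> symmetric_cone (\<odot>) e" for x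
  proof -
    have "0 \<le> l" if l: "l \<in> set (eig (D x))" for l
    proof -
      have "0 \<le> k \<and> k \<le> Max (set (eig x))" if "k \<in> set (eig x)" for k
        using x that by (simp add: symmetric_cone_def)
      thus ?thesis using majorized_by_bounds[OF maj _ l] by blast
    qed
    thus ?thesis by (simp add: symmetric_cone_def)
  qed
  moreover have "D e = e"
  proof -
    have "l = 1" if "l \<in> set (eig (D e))" for l
      using majorized_by_bounds[OF maj _ that, of 1 1] eigvals_unit by force
    thus ?thesis using constant_eigvals[of "D e" 1] by simp
  qed
  moreover have "adjoint D e = e"
  proof (rule vector_eq_ldot[THEN iffD1], rule allI)
    fix z
    have "inner z (adjoint D e) = inner (D z) e" by (rule adjoint_works[OF lin])
    also have "\<dots> = inner z e"
      using majorized_by_sum_list[OF maj[of z]] by (simp add: sum_list_eigvals)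
    finally show "inner z (adjoint D e) = inner z e" .
  qed
  ultimately show ?thesis using lin by (auto simp: doubly_stochastic_def)
qed

lemma eigvals_primitive:
  obtains c m where "eig c = 1 # replicate m 0" "eig (- c) = replicate m 0 @ [-1]"
proof -
  obtain es where "spectral_decomposition (\<odot>) e e (eig e) es" using eig_decomposition by blast
  hence frame: "jordan_frame (\<odot>) e es" by (simp add: spectral_decomposition_def)
  hence "es \<noteq> []" using unit_nonzero by (auto simp: jordan_frame_def)
  then obtain c fs where es: "es = c # fs" by (cases es) auto
  define m where "m = length fs"
  have dec: "spectral_decomposition (\<odot>) e c (1 # replicate m 0) es"
    using frame unfolding spectral_decomposition_def
    by (simp add: es m_def sum.lessThan_Suc_shift del: sum.lessThan_Suc)
  have zeros: "sorted_wrt (\<ge>) (replicate m (0 :: real))"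
    by (simp add: sorted_wrt_iff_nth_less)
  hence "sorted_wrt (\<ge>) (1 # replicate m (0 :: real))" by simp
  from eigvals_unique[OF dec this] have 1: "eig c = 1 # replicate m 0" .
  have "spectral_decomposition (\<odot>) e (- c) (replicate m 0 @ [-1]) (rev es)"
    using spectral_decomposition_rev[OF spectral_decomposition_scale[OF dec, of "-1"]] by simp
  moreover have "sorted_wrt (\<ge>) (replicate m 0 @ [-1 :: real])"
    using zeros by (simp add: sorted_wrt_append)
  ultimately have "eig (- c) = replicate m 0 @ [-1]" by (rule eigvals_unique)
  with 1 show ?thesis by (rule that)
qed

lemma sum_list_product_zeros: "length p = m \<Longrightarrow> sum_list (p \<star> replicate m 0) = 0"
  unfolding componentwise_product_def by (induction m arbitrary: p) (auto simp: length_Suc_conv)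

text \<open>The trace of \<open>T c\<close> for a primitive \<open>c\<close> is the first entry of \<open>q\<close>, and the trace of \<open>T (- c)\<close> is
minus the last. Linearity of \<open>T\<close> identifies the two entries.\<close>

lemma constant_multiplier:
  assumes lin: "linear T" and q: "length q = jrank (\<odot>) e" "sorted_wrt (\<ge>) q"
    and maj: "\<And>x. eig (T x) \<prec> q \<star> eig x"
  obtains t where "q = replicate (jrank (\<odot>) e) t"
proof -
  obtain c m where c: "eig c = 1 # replicate m 0" "eig (- c) = replicate m 0 @ [-1]"
    by (rule eigvals_primitive)
  hence len: "length q = Suc m" using q(1) length_eigvals[of c] by simp
  obtain a p where ap: "q = a # p" "length p = m" using len by (cases q) auto
  obtain p' b where pb: "q = p' @ [b]" "length p' = m" using len by (cases q rule: rev_cases) auto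
  have "inner (T c) e = sum_list (q \<star> eig c)"
    using majorized_by_sum_list[OF maj[of c]] by (simp add: sum_list_eigvals)
  also have "\<dots> = a"
    using sum_list_product_zeros[OF ap(2)] by (simp add: ap(1) c componentwise_product_def)
  finally have 1: "inner (T c) e = a" .
  have "inner (T (- c)) e = sum_list (q \<star> eig (- c))"
    using majorized_by_sum_list[OF maj[of "- c"]] by (simp add: sum_list_eigvals)
  also have "\<dots> = - b"
    using sum_list_product_zeros[OF pb(2)] pb(2) by (simp add: pb(1) c componentwise_product_def)
  finally have "a = b" using 1 by (simp add: linear_neg[OF lin])
  have "l = a" if "l \<in> set q" for l
  proof -
    have "l \<le> a" using that q(2) by (auto simp: ap(1))
    moreover have "b \<le> l" using that q(2) by (auto simp: pb(1) sorted_wrt_append)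
    ultimately show ?thesis using \<open>a = b\<close> by simp
  qed
  hence "q = replicate (length q) a" by (simp add: replicate_eqI)
  with that q(1) show ?thesis by metis
qed

text \<open>For negative \<open>t\<close> the two lists on the right differ in order, but majorization only depends on the
multiset of entries.\<close>

lemma majorized_by_constant_multiple:
  "p \<prec> replicate (jrank (\<odot>) e) t \<star> eig x \<longleftrightarrow> p \<prec> eig (t *\<^sub>R x)"
proof -
  have "replicate (jrank (\<odot>) e) t \<star> eig x = map ((*) t) (eig x)"
    by (simp add: componentwise_product_def zip_replicate1 length_eigvals[symmetric, of x] case_prod_beta o_def)
  thus ?thesis using majorized_by_cong_mset[OF mset_eigvals_scale[of t x]] by simp
qed

text \<open>For \<open>t \<noteq> 0\<close> the map \<open>T / t\<close>, evaluated as \<open>T (x / t)\<close>, satisfies the majorization without a factor,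
whatever the sign of \<open>t\<close>. For \<open>t = 0\<close> the map \<open>T\<close> vanishes and the identity can serve as \<open>D\<close>.\<close>

lemma scaled_doubly_stochastic_if_majorizing:
  assumes lin: "linear T" and maj: "\<And>x. eig (T x) \<prec> eig (t *\<^sub>R x)"
  shows "\<exists>D. doubly_stochastic (\<odot>) e D \<and> (\<forall>x. T x = t *\<^sub>R D x)"
proof (cases "t = 0")
  case True
  have zero: "l = 0" if "l \<in> set (eig (0 *\<^sub>R x))" for l x
  proof -
    have "set (eig (0 *\<^sub>R x)) = set (map ((*) 0) (eig x))"
      using mset_eigvals_scale mset_eq_setD by blast
    thus ?thesis using that by auto
  qed
  have "T x = 0" for x
  proof -
    have "l = 0" if "l \<in> set (eig (T x))" for l
      using majorized_by_bounds[OF maj[of x] _ that, of 0 0] zero[of _ x] True by force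
    thus ?thesis using constant_eigvals[of "T x" 0] by simp
  qed
  moreover have "doubly_stochastic (\<odot>) e (\<lambda>x. x)"
    using linear_id by (intro doubly_stochastic_if_majorizing) (simp_all add: majorized_by_def id_def)
  ultimately show ?thesis using True by auto
next
  case False
  define D where "D = (\<lambda>x. T ((1 / t) *\<^sub>R x))"
  have "linear D"
    unfolding D_def using linear_compose[OF linear_scale_self lin, of "1 / t"] by (simp add: o_def)
  moreover have "eig (D x) \<prec> eig x" for x
    using maj[of "(1 / t) *\<^sub>R x"] False by (simp add: D_def)
  ultimately have "doubly_stochastic (\<odot>) e D" by (rule doubly_stochastic_if_majorizing)
  moreover have "T x = t *\<^sub>R D x" for x
    using False by (simp add: D_def linear_scale[OF lin])
  ultimately show ?thesis by blast
qed

end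

theorem theorem3p5:
  fixes jprod :: "'a::euclidean_space \<Rightarrow> 'a \<Rightarrow> 'a"
    and e :: 'a
    and T :: "'a \<Rightarrow> 'a"
    and n :: nat
  assumes "euclidean_jordan_algebra jprod e"
    and "carries_trace_inner_product jprod e"
    and "n = jrank jprod e"
    and "linear T"
  shows "(\<exists>q :: real list. length q = n \<and> sorted_wrt (\<ge>) q \<and>
            (\<forall>x. eigvals jprod e (T x) \<prec> q \<star> eigvals jprod e x))
     \<longleftrightarrow> (\<exists>(t :: real) D. doubly_stochastic jprod e D \<and> (\<forall>x. T x = t *\<^sub>R D x))"
proof -
  interpret trace_jordan_algebra jprod e
    using assms(1,2) by (simp add: trace_jordan_algebra_def trace_jordan_algebra_axioms_def)
  show ?thesis
  proof
    assume "\<exists>q :: real list. length q = n \<and> sorted_wrt (\<ge>) q \<and>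
      (\<forall>x. eigvals jprod e (T x) \<prec> q \<star> eigvals jprod e x)"
    then obtain q where q: "length q = jrank jprod e" "sorted_wrt (\<ge>) q"
      and maj: "\<And>x. eigvals jprod e (T x) \<prec> q \<star> eigvals jprod e x"
      using assms(3) by blast
    obtain t where "q = replicate (jrank jprod e) t"
      by (rule constant_multiplier[OF assms(4) q maj])
    with maj have "eigvals jprod e (T x) \<prec> eigvals jprod e (t *\<^sub>R x)" for x
      by (simp add: majorized_by_constant_multiple)
    thus "\<exists>t D. doubly_stochastic jprod e D \<and> (\<forall>x. T x = t *\<^sub>R D x)"
      using scaled_doubly_stochastic_if_majorizing[OF assms(4)] by blast
  next
    assume "\<exists>t D. doubly_stochastic jprod e D \<and> (\<forall>x. T x = t *\<^sub>R D x)"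
    then obtain t D where D: "doubly_stochastic jprod e D" and T: "\<And>x. T x = t *\<^sub>R D x" by blast
    have lin: "linear D" using D by (simp add: doubly_stochastic_def)
    have "eigvals jprod e (T x) \<prec> replicate n t \<star> eigvals jprod e x" for x
      using doubly_stochastic_majorization[OF D, of "t *\<^sub>R x"]
      by (simp add: T assms(3) majorized_by_constant_multiple linear_scale[OF lin])
    thus "\<exists>q :: real list. length q = n \<and> sorted_wrt (\<ge>) q \<and>
      (\<forall>x. eigvals jprod e (T x) \<prec> q \<star> eigvals jprod e x)"
      by (intro exI[of _ "replicate n t"]) (simp add: sorted_wrt_iff_nth_less)
  qed
qed

end
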